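(* Let $f$ be a complex-valued harmonic function in the unit disk $\mathbb{U}$ with $L^+(f)<\infty$, and let $d$ be the diameter of $f(\mathbb{U})$. Then (i) $\pi\Lambda_f(0)\le 2d$; (ii) $2d\le L^+(f)$. For every $d>0$, the function $u_d(z)=\frac{d}{\pi}\arg\frac{1+z}{1-z}$ on $\mathbb{U}$ (whose image has diameter $d$) satisfies (i) with equality.
   Context: $\mathbb{U}$ is the open unit disk in $\mathbb{C}$. $L^+(f)=\sup_{0\le r<1}L(f,r)$, where $L(f,r)$ is the length of the curve $t\mapsto f(re^{it})$, $t\in[0,2\pi]$. $\Lambda_f(z)=|\partial f(z)|+|\bar\partial f(z)|$ is the operator norm of the differential of $f$ at $z$. The argument in $u_d$ takes values in $(-\pi/2,\pi/2)$. *)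

theory Defs
  imports "HOL-Analysis.Analysis"
begin

definition partial_x :: "(complex \<Rightarrow> complex) \<Rightarrow> complex \<Rightarrow> complex" where
  "partial_x f z = frechet_derivative f (at z) 1"

definition partial_y :: "(complex \<Rightarrow> complex) \<Rightarrow> complex \<Rightarrow> complex" where
  "partial_y f z = frechet_derivative f (at z) \<i>"

(* Twice continuously differentiable with vanishing Laplacian. The differentiability clauses
   guarantee that every Frechet derivative occurring below is a genuine one on S. *)
definition harmonic_on :: "(complex \<Rightarrow> complex) \<Rightarrow> complex set \<Rightarrow> bool" where
  "harmonic_on f S \<longleftrightarrow>
     open S \<and>
     (\<forall>z\<in>S. f differentiable at z \<and> partial_x f differentiable at z \<and>
            partial_y f differentiable at z) \<and>
     continuous_on S (partial_x (partial_x f)) \<and>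
     continuous_on S (partial_x (partial_y f)) \<and>
     continuous_on S (partial_y (partial_x f)) \<and>
     continuous_on S (partial_y (partial_y f)) \<and>
     (\<forall>z\<in>S. partial_x (partial_x f) z + partial_y (partial_y f) z = 0)"

definition wirtinger_d :: "(complex \<Rightarrow> complex) \<Rightarrow> complex \<Rightarrow> complex" where
  "wirtinger_d f z = (partial_x f z - \<i> * partial_y f z) / 2"

definition wirtinger_dbar :: "(complex \<Rightarrow> complex) \<Rightarrow> complex \<Rightarrow> complex" where
  "wirtinger_dbar f z = (partial_x f z + \<i> * partial_y f z) / 2"

definition Lambda_norm :: "(complex \<Rightarrow> complex) \<Rightarrow> complex \<Rightarrow> real" where
  "Lambda_norm f z = cmod (wirtinger_d f z) + cmod (wirtinger_dbar f z)"

(* Supremum of the lengths of inscribed polygons over all partitions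
   a = t 0 \<le> t 1 \<le> \<dots> \<le> t n = b; the value \<infinity> is allowed. *)
definition curve_length :: "(real \<Rightarrow> 'a::metric_space) \<Rightarrow> real \<Rightarrow> real \<Rightarrow> ennreal" where
  "curve_length \<gamma> a b =
     (SUP (n, t) \<in> {(n::nat, t::nat \<Rightarrow> real). mono_on {..n} t \<and> t 0 = a \<and> t n = b}.
        ennreal (\<Sum>i<n. dist (\<gamma> (t i)) (\<gamma> (t (Suc i)))))"

definition circle_length :: "(complex \<Rightarrow> complex) \<Rightarrow> real \<Rightarrow> ennreal" where
  "circle_length f r = curve_length (\<lambda>t. f (of_real r * cis t)) 0 (2 * pi)"

definition L_plus :: "(complex \<Rightarrow> complex) \<Rightarrow> ennreal" where
  "L_plus f = (SUP r\<in>{0..<1}. circle_length f r)"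

(* For z in the unit disk, (1 + z) / (1 - z) has positive real part, so its principal argument
   Arg is the one in (-pi/2, pi/2). *)
definition u_fun :: "real \<Rightarrow> complex \<Rightarrow> complex" where
  "u_fun d z = of_real (d / pi * Arg ((1 + z) / (1 - z)))"

end

theory Submission
  imports Defs "HOL-Complex_Analysis.Complex_Analysis"
begin

text \<open>
  On the disk a complex-valued harmonic function is \<open>f = G + cnj \<circ> K\<close> with \<open>G\<close> and \<open>K\<close> holomorphic
  (\<open>harmonic_on_imp_canonical_rep\<close>): by the vanishing Laplacian \<open>wirtinger_d f\<close> and the conjugate of
  \<open>wirtinger_dbar f\<close> satisfy the Cauchy-Riemann equations, and \<open>G\<close> and \<open>K\<close> are their primitives.
  In particular \<open>Lambda_norm f 0\<close> is \<open>cmod (deriv G 0) + cmod (deriv K 0)\<close>. Moreover, for unimodular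
  \<open>\<omega>\<close> the real part of \<open>\<omega> * f\<close> is that of the holomorphic function \<open>\<omega> * G + cnj \<omega> * K\<close>, which
  reduces both inequalities to facts about holomorphic functions.

  The diameter is at most half the length: by the maximum principle, used once for each of two
  points, the distance of two values of \<open>f\<close> in a disk of radius \<open>r < 1\<close> is at most the
  largest distance of two values on the bounding circle (\<open>canonical_rep_dist_le_sphere\<close>). The
  circle's image is a closed curve, and both arcs between two of its points are at least as long as
  the chord (\<open>twice_dist_le_closed_curve_length\<close>).

  The gradient bound: choose \<open>\<omega>\<close> so that \<open>\<omega> * deriv G 0\<close> and \<open>cnj \<omega> * deriv K 0\<close> point in the same
  direction. The odd part of \<open>\<omega> * G + cnj \<omega> * K\<close> has a derivative of modulus \<open>Lambda_norm f 0\<close> at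
  \<open>0\<close>, and its real part is that of \<open>\<omega> * (f z - f (- z)) / 2\<close>, hence bounded by half the
  diameter. A holomorphic map of the disk into a strip, fixing \<open>0\<close>, becomes a self-map of the disk
  when followed by a scaled tangent, and the Schwarz lemma bounds its derivative
  (\<open>strip_derivative_bound\<close>, \<open>Lambda_norm_bound\<close>).

  The functions \<open>u_fun d\<close> are, up to scaling, the imaginary part of the logarithm of a Moebius
  transformation onto the right half-plane, that is, of a conformal map onto a strip, where the
  Schwarz lemma is sharp. Explicitly they are an arctangent (\<open>u_fun_eq_arctan\<close>), from which the
  finite length and the diameter of the image are read off.
\<close>

section \<open>Symmetry of mixed derivatives\<close>

text \<open>Freeze the increment \<open>h *\<^sub>R v\<close> and compare \<open>f\<close> along the two parallel segments in
  direction \<open>u\<close>. The derivative of their difference is a difference of two values of \<open>f' _ u\<close>,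
  which \<open>A\<close> predicts up to \<open>o(h)\<close>; the mean value inequality gains a further factor \<open>h\<close>.
  The second difference itself is symmetric in \<open>u\<close> and \<open>v\<close>, while the conclusion
  approximates it by a term depending on the order of differentiation.\<close>

lemma second_difference_estimate:
  fixes f :: "'a::real_normed_vector \<Rightarrow> 'b::real_normed_vector"
  assumes S: "open S" "x \<in> S"
    and f: "\<And>y. y \<in> S \<Longrightarrow> (f has_derivative f' y) (at y)"
    and A: "((\<lambda>y. f' y u) has_derivative A) (at x)"
    and e: "e > 0"
  shows "\<exists>d>0. \<forall>h. 0 < h \<and> h < d \<longrightarrow>
    norm (f (x + h *\<^sub>R u + h *\<^sub>R v) - f (x + h *\<^sub>R u) - f (x + h *\<^sub>R v) + f x
      - (h * h) *\<^sub>R A v) \<le> e * (h * h)"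
proof -
  \<comment> \<open>The summand \<open>1\<close> keeps \<open>N\<close> positive when \<open>u\<close> and \<open>v\<close> vanish.\<close>
  define N where "N = 1 + norm u + norm v"
  have N: "N > 0" "norm u + norm v \<le> N"
    unfolding N_def by (smt (verit) norm_ge_zero)+
  define e' where "e' = e / (2 * N)"
  have e': "e' > 0" using e N by (simp add: e'_def)
  obtain r where r: "r > 0" "ball x r \<subseteq> S" using S by (metis openE)
  obtain d where d: "d > 0"
    "\<And>y. norm (y - x) < d \<Longrightarrow> norm (f' y u - f' x u - A (y - x)) \<le> e' * norm (y - x)"
    using A e' unfolding has_derivative_at_alt by metis
  have lin: "linear A" using A has_derivative_linear by blast
  show ?thesis
  proof (intro exI[of _ "min r d / N"] conjI allI impI)
    show "min r d / N > 0" using r d N by simp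
    fix h :: real assume h: "0 < h \<and> h < min r d / N"
    then have hN: "h * N < r" "h * N < d" using N by (auto simp: field_simps)
    define \<phi> where "\<phi> s = f (x + s *\<^sub>R u + h *\<^sub>R v) - f (x + s *\<^sub>R u) - s *\<^sub>R h *\<^sub>R A v" for s
    have near: "norm (s *\<^sub>R u + c *\<^sub>R v) \<le> h * N" if "s \<in> {0..h}" "c \<in> {0..h}" for s c
    proof -
      have "norm (s *\<^sub>R u + c *\<^sub>R v) \<le> s * norm u + c * norm v"
        using that norm_triangle_ineq[of "s *\<^sub>R u" "c *\<^sub>R v"] by simp
      also have "\<dots> \<le> h * norm u + h * norm v"
        using that by (intro add_mono mult_right_mono) auto
      also have "\<dots> \<le> h * N" using N h by (metis distrib_left less_le mult_left_mono)
      finally show ?thesis .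
    qed
    have bd: "norm (f' (x + s *\<^sub>R u + h *\<^sub>R v) u - f' (x + s *\<^sub>R u) u - h *\<^sub>R A v) \<le> e * h"
      if s: "s \<in> {0..h}" for s
    proof -
      have n1: "norm (s *\<^sub>R u + h *\<^sub>R v) \<le> h * N" using near[OF s, of h] h by auto
      have n2: "norm (s *\<^sub>R u) \<le> h * N" using near[OF s, of 0] h by auto
      have b: "norm (f' (x + w) u - f' x u - A w) \<le> e' * (h * N)" if w: "norm w \<le> h * N" for w
      proof -
        have "norm (f' (x + w) u - f' x u - A w) \<le> e' * norm w"
          using d(2)[of "x + w"] w hN by simp
        also have "\<dots> \<le> e' * (h * N)" using w e' by (intro mult_left_mono) auto
        finally show ?thesis .
      qed
      note b1 = b[OF n1, folded add.assoc] and b2 = b[OF n2]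
      have "norm ((f' (x + s *\<^sub>R u + h *\<^sub>R v) u - f' x u - A (s *\<^sub>R u + h *\<^sub>R v))
         - (f' (x + s *\<^sub>R u) u - f' x u - A (s *\<^sub>R u))) \<le> e' * (h * N) + e' * (h * N)"
        using b1 b2 norm_triangle_ineq4 by (smt (verit))
      also have "e' * (h * N) + e' * (h * N) = e * h" using N by (simp add: e'_def field_simps)
      finally show ?thesis
        by (simp add: linear_add[OF lin] linear_scale[OF lin] algebra_simps)
    qed
    have "norm (\<phi> h - \<phi> 0) \<le> (e * h) * norm (h - 0)"
    proof (rule differentiable_bound[of "{0..h}" \<phi>
        "\<lambda>s t. t *\<^sub>R (f' (x + s *\<^sub>R u + h *\<^sub>R v) u - f' (x + s *\<^sub>R u) u - h *\<^sub>R A v)"])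
      fix s assume s: "s \<in> {0..h}"
      have i1: "x + s *\<^sub>R u + h *\<^sub>R v \<in> S" "x + s *\<^sub>R u \<in> S"
        using near[OF s, of h] near[OF s, of 0] h hN r(2)
        by (auto simp: subset_iff dist_norm add.assoc norm_minus_commute)
      have l1: "linear (f' (x + s *\<^sub>R u + h *\<^sub>R v))" "linear (f' (x + s *\<^sub>R u))"
        using f[OF i1(1)] f[OF i1(2)] has_derivative_linear by blast+
      have 1: "((\<lambda>s. f (x + s *\<^sub>R u + h *\<^sub>R v)) has_derivative
          (\<lambda>t. f' (x + s *\<^sub>R u + h *\<^sub>R v) (t *\<^sub>R u))) (at s within {0..h})"
        by (rule has_derivative_compose[where f = "\<lambda>s. x + s *\<^sub>R u + h *\<^sub>R v" and g = f, OF _ f[OF i1(1)]]) (auto intro!: derivative_eq_intros)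
      have 2: "((\<lambda>s. f (x + s *\<^sub>R u)) has_derivative
          (\<lambda>t. f' (x + s *\<^sub>R u) (t *\<^sub>R u))) (at s within {0..h})"
        by (rule has_derivative_compose[where f = "\<lambda>s. x + s *\<^sub>R u" and g = f, OF _ f[OF i1(2)]]) (auto intro!: derivative_eq_intros)
      show "(\<phi> has_derivative (\<lambda>t. t *\<^sub>R (f' (x + s *\<^sub>R u + h *\<^sub>R v) u - f' (x + s *\<^sub>R u) u - h *\<^sub>R A v)))
        (at s within {0..h})"
        unfolding \<phi>_def
        by ((rule derivative_eq_intros 1 2 refl)+,
            simp add: fun_eq_iff linear_scale[OF l1(1)] linear_scale[OF l1(2)], simp add: algebra_simps)
      have "onorm (\<lambda>t::real. t *\<^sub>R (f' (x + s *\<^sub>R u + h *\<^sub>R v) u - f' (x + s *\<^sub>R u) u - h *\<^sub>R A v))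
        \<le> norm (f' (x + s *\<^sub>R u + h *\<^sub>R v) u - f' (x + s *\<^sub>R u) u - h *\<^sub>R A v)"
        by (rule onorm_le) (simp add: mult.commute)
      then show "onorm (\<lambda>t::real. t *\<^sub>R (f' (x + s *\<^sub>R u + h *\<^sub>R v) u - f' (x + s *\<^sub>R u) u - h *\<^sub>R A v)) \<le> e * h"
        using bd[OF s] by linarith
    qed (use h in auto)
    then show "norm (f (x + h *\<^sub>R u + h *\<^sub>R v) - f (x + h *\<^sub>R u) - f (x + h *\<^sub>R v) + f x
      - (h * h) *\<^sub>R A v) \<le> e * (h * h)"
      using h by (simp add: \<phi>_def algebra_simps)
  qed
qed

text \<open>Young's theorem. Both mixed second derivatives approximate the same symmetric second
  difference to order \<open>o(h * h)\<close>.\<close>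

lemma mixed_derivatives_commute:
  fixes f :: "'a::real_normed_vector \<Rightarrow> 'b::real_normed_vector"
  assumes S: "open S" "x \<in> S"
    and f: "\<And>y. y \<in> S \<Longrightarrow> (f has_derivative f' y) (at y)"
    and A: "((\<lambda>y. f' y u) has_derivative A) (at x)"
    and B: "((\<lambda>y. f' y v) has_derivative B) (at x)"
  shows "A v = B u"
proof -
  have "norm (A v - B u) \<le> 0 + e" if e: "e > 0" for e
  proof -
    obtain d1 where d1: "d1 > 0" "\<And>h. 0 < h \<and> h < d1 \<Longrightarrow>
      norm (f (x + h *\<^sub>R u + h *\<^sub>R v) - f (x + h *\<^sub>R u) - f (x + h *\<^sub>R v) + f x
      - (h * h) *\<^sub>R A v) \<le> e/2 * (h * h)"
      using second_difference_estimate[OF S f A, of "e/2" v] e by auto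
    obtain d2 where d2: "d2 > 0" "\<And>h. 0 < h \<and> h < d2 \<Longrightarrow>
      norm (f (x + h *\<^sub>R v + h *\<^sub>R u) - f (x + h *\<^sub>R v) - f (x + h *\<^sub>R u) + f x
      - (h * h) *\<^sub>R B u) \<le> e/2 * (h * h)"
      using second_difference_estimate[OF S f B, of "e/2" u] e by auto
    define h where "h = min d1 d2 / 2"
    have h: "0 < h" "h < d1" "h < d2" using d1 d2 by (auto simp: h_def)
    define D where "D = f (x + h *\<^sub>R u + h *\<^sub>R v) - f (x + h *\<^sub>R u) - f (x + h *\<^sub>R v) + f x"
    have 1: "norm (D - (h * h) *\<^sub>R A v) \<le> e/2 * (h * h)"
      using d1(2)[of h] h by (simp add: D_def)
    have 2: "norm (D - (h * h) *\<^sub>R B u) \<le> e/2 * (h * h)"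
      using d2(2)[of h] h by (simp add: D_def algebra_simps)
    have "(h * h) * norm (A v - B u) = norm ((D - (h * h) *\<^sub>R B u) - (D - (h * h) *\<^sub>R A v))"
      by (simp add: scaleR_diff_right[symmetric] h)
    also have "\<dots> \<le> e/2 * (h * h) + e/2 * (h * h)"
      using 1 2 norm_triangle_ineq4 by (smt (verit))
    finally have "(h * h) * norm (A v - B u) \<le> (h * h) * e" by (simp add: algebra_simps)
    then show ?thesis using h by simp
  qed
  then have "norm (A v - B u) \<le> 0" by (rule field_le_epsilon)
  then show ?thesis by simp
qed

section \<open>Harmonic functions as sums of holomorphic and antiholomorphic functions\<close>

text \<open>The canonical decomposition of a harmonic function into a holomorphic and an antiholomorphic
  part. Keeping the two parts as explicit arguments makes the family closed under
  \<open>partial_x\<close> and \<open>partial_y\<close>, with the parts of the result given by formulas.\<close>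

definition canonical_rep ::
  "complex set \<Rightarrow> (complex \<Rightarrow> complex) \<Rightarrow> (complex \<Rightarrow> complex) \<Rightarrow> (complex \<Rightarrow> complex) \<Rightarrow> bool" where
  "canonical_rep S f G K \<longleftrightarrow> open S \<and> G holomorphic_on S \<and> K holomorphic_on S \<and>
     (\<forall>z\<in>S. f z = G z + cnj (K z))"

lemma linear_complex_expand:
  assumes "linear (X :: complex \<Rightarrow> complex)"
  shows "X h = of_real (Re h) * X 1 + of_real (Im h) * X \<i>"
proof -
  have "h = Re h *\<^sub>R 1 + Im h *\<^sub>R \<i>" by (simp add: complex_eq_iff)
  then have "X h = X (Re h *\<^sub>R 1 + Im h *\<^sub>R \<i>)" by simp
  then show ?thesis
    unfolding linear_add[OF assms] linear_scale[OF assms] by (simp add: scaleR_conv_of_real)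
qed

lemma canonical_rep_has_derivative:
  assumes "canonical_rep S f G K" "z \<in> S"
  shows "(f has_derivative (\<lambda>h. deriv G z * h + cnj (deriv K z * h))) (at z)"
proof -
  have S: "open S" and hol: "G holomorphic_on S" "K holomorphic_on S"
    and eq: "\<And>w. w \<in> S \<Longrightarrow> f w = G w + cnj (K w)"
    using assms by (auto simp: canonical_rep_def)
  have G: "(G has_derivative (\<lambda>h. deriv G z * h)) (at z)"
    and K: "(K has_derivative (\<lambda>h. deriv K z * h)) (at z)"
    using holomorphic_derivI[OF hol(1) S assms(2)] holomorphic_derivI[OF hol(2) S assms(2)]
    by (simp_all add: has_field_derivative_def)
  have "((\<lambda>w. G w + cnj (K w)) has_derivative (\<lambda>h. deriv G z * h + cnj (deriv K z * h))) (at z)"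
    by (intro has_derivative_add G bounded_linear.has_derivative[OF bounded_linear_cnj] K)
  then show ?thesis
    using S assms(2) eq by (auto intro: has_derivative_transform_within_open)
qed

lemma
  assumes "canonical_rep S f G K" "z \<in> S"
  shows canonical_rep_differentiable: "f differentiable at z"
    and partial_x_canonical_rep: "partial_x f z = deriv G z + cnj (deriv K z)"
    and partial_y_canonical_rep: "partial_y f z = \<i> * deriv G z + cnj (\<i> * deriv K z)"
proof -
  note D = canonical_rep_has_derivative[OF assms]
  show "f differentiable at z" using D by (auto simp: differentiable_def)
  have "frechet_derivative f (at z) = (\<lambda>h. deriv G z * h + cnj (deriv K z * h))"
    using frechet_derivative_at[OF D] by simp
  then show "partial_x f z = deriv G z + cnj (deriv K z)"
    and "partial_y f z = \<i> * deriv G z + cnj (\<i> * deriv K z)"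
    by (simp_all add: partial_x_def partial_y_def mult.commute)
qed

text \<open>The Wirtinger derivatives see only one part each: \<open>wirtinger_d\<close> kills the antiholomorphic
  part and \<open>wirtinger_dbar\<close> the holomorphic one.\<close>

lemma Lambda_norm_canonical_rep:
  assumes "canonical_rep S f G K" "z \<in> S"
  shows "Lambda_norm f z = cmod (deriv G z) + cmod (deriv K z)"
proof -
  have "wirtinger_d f z = deriv G z" "wirtinger_dbar f z = cnj (deriv K z)"
    by (simp_all add: wirtinger_d_def wirtinger_dbar_def partial_x_canonical_rep[OF assms]
        partial_y_canonical_rep[OF assms] algebra_simps)
  then show ?thesis by (simp add: Lambda_norm_def)
qed

lemma canonical_rep_partial_x:
  assumes "canonical_rep S f G K"
  shows "canonical_rep S (partial_x f) (deriv G) (deriv K)"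
  using assms partial_x_canonical_rep[OF assms]
  by (auto simp: canonical_rep_def intro: holomorphic_deriv)

lemma canonical_rep_partial_y:
  assumes "canonical_rep S f G K"
  shows "canonical_rep S (partial_y f) (\<lambda>z. \<i> * deriv G z) (\<lambda>z. \<i> * deriv K z)"
  using assms partial_y_canonical_rep[OF assms]
  by (auto simp: canonical_rep_def intro!: holomorphic_intros)

lemma canonical_rep_continuous_on:
  assumes "canonical_rep S f G K"
  shows "continuous_on S f"
  using canonical_rep_differentiable[OF assms]
  by (intro differentiable_imp_continuous_on)
     (auto simp: differentiable_on_def intro: differentiable_at_withinI)

text \<open>All derivatives up to the second order are again of the form \<open>G + cnj \<circ> K\<close>, which settles
  differentiability and continuity at once. The Laplacian vanishes because two derivatives
  in direction \<open>\<i>\<close> produce the factor \<open>\<i> * \<i> = -1\<close>, in either part.\<close>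

lemma canonical_rep_imp_harmonic_on:
  assumes f: "canonical_rep S f G K"
  shows "harmonic_on f S"
proof -
  note x = canonical_rep_partial_x[OF f] and y = canonical_rep_partial_y[OF f]
  note xx = canonical_rep_partial_x[OF x] and yx = canonical_rep_partial_y[OF x]
  note xy = canonical_rep_partial_x[OF y] and yy = canonical_rep_partial_y[OF y]
  have S: "open S" "G holomorphic_on S" "K holomorphic_on S"
    using f by (auto simp: canonical_rep_def)
  have "partial_x (partial_x f) z + partial_y (partial_y f) z = 0" if z: "z \<in> S" for z
  proof -
    have "deriv G field_differentiable at z" "deriv K field_differentiable at z"
      using S z holomorphic_deriv holomorphic_on_imp_differentiable_at by blast+
    then have "deriv (\<lambda>z. \<i> * deriv G z) z = \<i> * deriv (deriv G) z"
      "deriv (\<lambda>z. \<i> * deriv K z) z = \<i> * deriv (deriv K) z"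
      by (simp_all add: deriv_cmult)
    then show ?thesis
      using partial_x_canonical_rep[OF x z] partial_y_canonical_rep[OF y z] by simp
  qed
  then show ?thesis
    unfolding harmonic_on_def
    using S canonical_rep_differentiable[OF f] canonical_rep_differentiable[OF x]
      canonical_rep_differentiable[OF y] canonical_rep_continuous_on[OF xx]
      canonical_rep_continuous_on[OF xy] canonical_rep_continuous_on[OF yx]
      canonical_rep_continuous_on[OF yy]
    by blast
qed

text \<open>The vanishing Laplacian, together with the symmetry of the mixed partial derivatives, is the
  Cauchy-Riemann system for \<open>wirtinger_d f\<close> and for the conjugate of \<open>wirtinger_dbar f\<close>.
  Convexity provides primitives \<open>G\<close> and \<open>K\<close> of these two holomorphic functions, and
  \<open>G + cnj \<circ> K\<close> then has the same derivative as \<open>f\<close>.\<close>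

lemma harmonic_on_imp_canonical_rep:
  assumes f: "harmonic_on f S" and "convex S"
  obtains G K where "canonical_rep S f G K"
proof -
  have S: "open S" using f by (simp add: harmonic_on_def)
  have Df: "(f has_derivative frechet_derivative f (at z)) (at z)"
    and Dx: "(partial_x f has_derivative frechet_derivative (partial_x f) (at z)) (at z)"
    and Dy: "(partial_y f has_derivative frechet_derivative (partial_y f) (at z)) (at z)"
    and lap: "partial_x (partial_x f) z + partial_y (partial_y f) z = 0"
    if "z \<in> S" for z
    using f that frechet_derivative_works unfolding harmonic_on_def by blast+
  have sym: "partial_y (partial_x f) z = partial_x (partial_y f) z" if z: "z \<in> S" for z
  proof -
    have "frechet_derivative (partial_x f) (at z) \<i> = frechet_derivative (partial_y f) (at z) 1"
    proof (rule mixed_derivatives_commute[where u = 1 and v = \<i> and f = f and f' = "\<lambda>y. frechet_derivative f (at y)", OF S z])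
      show "((\<lambda>y. frechet_derivative f (at y) 1) has_derivative frechet_derivative (partial_x f) (at z)) (at z)"
        using Dx[OF z] unfolding partial_x_def[abs_def] .
      show "((\<lambda>y. frechet_derivative f (at y) \<i>) has_derivative frechet_derivative (partial_y f) (at z)) (at z)"
        using Dy[OF z] unfolding partial_y_def[abs_def] .
    qed (rule Df)
    then show ?thesis by (simp add: partial_x_def[of "partial_y f"] partial_y_def[of "partial_x f"])
  qed
  have ex: "frechet_derivative (partial_x f) (at z) h =
      of_real (Re h) * partial_x (partial_x f) z + of_real (Im h) * partial_y (partial_x f) z"
    and ey: "frechet_derivative (partial_y f) (at z) h =
      of_real (Re h) * partial_x (partial_y f) z + of_real (Im h) * partial_y (partial_y f) z"
    and ef: "frechet_derivative f (at z) h = of_real (Re h) * partial_x f z + of_real (Im h) * partial_y f z"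
    if z: "z \<in> S" for z h
    using linear_complex_expand[OF has_derivative_linear[OF Dx[OF z]], of h]
      linear_complex_expand[OF has_derivative_linear[OF Dy[OF z]], of h]
      linear_complex_expand[OF has_derivative_linear[OF Df[OF z]], of h]
    by (simp_all add: partial_x_def partial_y_def)
  define p where "p = wirtinger_d f"
  define q where "q z = cnj (wirtinger_dbar f z)" for z
  have "p holomorphic_on S" "q holomorphic_on S"
  proof -
    have yy: "partial_y (partial_y f) z = - partial_x (partial_x f) z" if "z \<in> S" for z
      using lap[OF that] by (simp add: eq_neg_iff_add_eq_0 add.commute)
    have "(p has_field_derivative
        (partial_x (partial_x f) z - \<i> * partial_x (partial_y f) z) / 2) (at z)" if z: "z \<in> S" for z
      unfolding has_field_derivative_def p_def wirtinger_d_def[abs_def]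
      by (rule derivative_eq_intros Dx[OF z] Dy[OF z] refl | simp)+
         (simp add: fun_eq_iff ex[OF z] ey[OF z] sym[OF z] yy[OF z] complex_eq_iff field_simps)
    then show "p holomorphic_on S" using S by (auto simp: holomorphic_on_open)
    have "(q has_field_derivative
        cnj ((partial_x (partial_x f) z + \<i> * partial_x (partial_y f) z) / 2)) (at z)" if z: "z \<in> S" for z
      unfolding has_field_derivative_def q_def[abs_def] wirtinger_dbar_def[abs_def]
      by (rule derivative_eq_intros bounded_linear.has_derivative[OF bounded_linear_cnj] Dx[OF z] Dy[OF z] refl | simp)+
         (simp add: fun_eq_iff ex[OF z] ey[OF z] sym[OF z] yy[OF z] complex_eq_iff field_simps)
    then show "q holomorphic_on S" using S by (auto simp: holomorphic_on_open)
  qed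
  then obtain G K where
    G: "\<And>z. z \<in> S \<Longrightarrow> (G has_field_derivative p z) (at z within S)" and
    K: "\<And>z. z \<in> S \<Longrightarrow> (K has_field_derivative q z) (at z within S)"
    using holomorphic_convex_primitive'[OF \<open>convex S\<close> S] by metis
  define E where "E z = f z - G z - cnj (K z)" for z
  have "(E has_derivative (\<lambda>h. 0)) (at z within S)" if z: "z \<in> S" for z
    unfolding E_def[abs_def]
    by (rule derivative_eq_intros bounded_linear.has_derivative[OF bounded_linear_cnj]
          has_derivative_at_withinI[OF Df[OF z]]
          G[OF z, unfolded has_field_derivative_def] K[OF z, unfolded has_field_derivative_def] refl)+
       (simp add: fun_eq_iff ef[OF z] p_def q_def wirtinger_d_def wirtinger_dbar_def complex_eq_iff field_simps)
  then obtain c where c: "\<And>z. z \<in> S \<Longrightarrow> E z = c"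
    using has_derivative_zero_constant[OF \<open>convex S\<close>, of E] by auto
  have "canonical_rep S f (\<lambda>z. G z + c) K"
    unfolding canonical_rep_def
  proof (intro conjI ballI)
    show "K holomorphic_on S"
      using K unfolding holomorphic_on_def field_differentiable_def by blast
    have "G holomorphic_on S"
      using G unfolding holomorphic_on_def field_differentiable_def by blast
    then show "(\<lambda>z. G z + c) holomorphic_on S" by (intro holomorphic_intros)
    show "f z = G z + c + cnj (K z)" if "z \<in> S" for z
      using c[OF that] by (auto simp: E_def algebra_simps)
  qed (rule S)
  then show ?thesis by (rule that)
qed

section \<open>The maximum principle for differences of values\<close>

lemma unimodular_rotation_to_norm:
  obtains \<omega> :: complex where "cmod \<omega> = 1" "Re (\<omega> * w) = cmod w"
proof (cases "w = 0")
  case True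
  then show ?thesis using that[of 1] by simp
next
  case False
  have "sgn w * cnj (sgn w) = 1" using False by (simp add: complex_norm_square[symmetric] norm_sgn)
  moreover have "w = of_real (cmod w) * sgn w" using False by (simp add: sgn_eq)
  ultimately have "cnj (sgn w) * w = of_real (cmod w)"
    by (metis mult.assoc mult.commute mult.right_neutral)
  then show ?thesis using that[of "cnj (sgn w)"] False by (simp add: norm_sgn)
qed

text \<open>After a rotation \<open>\<omega>\<close> the modulus at \<open>z\<close> is a real part, and since
  \<open>Re (\<omega> * cnj w) = Re (cnj \<omega> * w)\<close> the real part of \<open>\<omega> * (f - c)\<close> is that of a holomorphic
  function. So the maximum principle for real parts of holomorphic functions applies.\<close>

lemma canonical_rep_maximum_principle:
  assumes f: "canonical_rep S f G K" and r: "r > 0" "cball 0 r \<subseteq> S"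
    and bd: "\<And>a. a \<in> sphere 0 r \<Longrightarrow> cmod (f a - c) \<le> B"
    and z: "z \<in> cball 0 r"
  shows "cmod (f z - c) \<le> B"
proof -
  obtain \<omega> where \<omega>: "cmod \<omega> = 1" "Re (\<omega> * (f z - c)) = cmod (f z - c)"
    by (rule unimodular_rotation_to_norm)
  define H where "H w = \<omega> * (G w - c) + cnj \<omega> * K w" for w
  have ReH: "Re (H w) = Re (\<omega> * (f w - c))" if "w \<in> cball 0 r" for w
    using f r that by (auto simp: H_def canonical_rep_def subset_iff algebra_simps)
  have holH: "H holomorphic_on S"
    using f by (auto simp: H_def[abs_def] canonical_rep_def intro!: holomorphic_intros)
  have "Re (H z) \<le> B"
  proof (rule maximum_real_frontier[of H "cball 0 r"])
    show "H holomorphic_on interior (cball 0 r)"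
      using holH r by (meson holomorphic_on_subset interior_subset order_trans)
    show "continuous_on (closure (cball 0 r)) H"
      using holH r by (simp add: holomorphic_on_imp_continuous_on holomorphic_on_subset)
    show "Re (H w) \<le> B" if "w \<in> frontier (cball 0 r)" for w
    proof -
      have w: "w \<in> sphere 0 r" using that r by simp
      then have "Re (H w) = Re (\<omega> * (f w - c))" by (intro ReH) simp
      then have "Re (H w) \<le> cmod (\<omega> * (f w - c))" by (simp only: complex_Re_le_cmod)
      then show ?thesis using bd[OF w] \<omega> by (simp add: norm_mult)
    qed
  qed (use z in auto)
  then show ?thesis using ReH[OF z] \<omega> by simp
qed

text \<open>The maximum principle is used twice, moving one of the two points to the circle each time.\<close>

lemma canonical_rep_dist_le_sphere:
  assumes f: "canonical_rep S f G K" and r: "r > 0" "cball 0 r \<subseteq> S"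
    and bd: "\<And>a b. a \<in> sphere 0 r \<Longrightarrow> b \<in> sphere 0 r \<Longrightarrow> dist (f a) (f b) \<le> B"
    and z: "z \<in> cball 0 r" "w \<in> cball 0 r"
  shows "dist (f z) (f w) \<le> B"
proof -
  have "cmod (f z - f b) \<le> B" if "b \<in> sphere 0 r" for b
    by (rule canonical_rep_maximum_principle[OF f r _ z(1)]) (use bd that in \<open>auto simp: dist_norm\<close>)
  then have "cmod (f w - f z) \<le> B"
    by (intro canonical_rep_maximum_principle[OF f r _ z(2)]) (auto simp: norm_minus_commute)
  then show ?thesis by (simp add: dist_norm norm_minus_commute)
qed

section \<open>Curve length and the diameter of the image\<close>

lemma polygon_le_curve_length:
  assumes "mono_on {..n} t" "t 0 = a" "t n = b"
  shows "ennreal (\<Sum>i<n. dist (\<gamma> (t i)) (\<gamma> (t (Suc i)))) \<le> curve_length \<gamma> a b"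
  unfolding curve_length_def using assms by (intro SUP_upper2[of "(n, t)"]) auto

text \<open>Two points of a closed curve cut it into two arcs, each at least as long as the chord.\<close>

lemma twice_dist_le_closed_curve_length:
  fixes \<gamma> :: "real \<Rightarrow> 'a::metric_space"
  assumes closed: "\<gamma> a = \<gamma> b" and st: "s \<in> {a..b}" "t \<in> {a..b}"
  shows "ennreal (2 * dist (\<gamma> s) (\<gamma> t)) \<le> curve_length \<gamma> a b"
  using st
proof (induction s t rule: linorder_wlog)
  case (le s t)
  define \<tau> where "\<tau> i = [a, s, t, b] ! i" for i
  have m: "mono_on {..3} \<tau>"
    using le by (auto simp: mono_on_def \<tau>_def le_Suc_eq numeral_3_eq_3)
  have "2 * dist (\<gamma> s) (\<gamma> t) \<le> dist (\<gamma> a) (\<gamma> s) + dist (\<gamma> s) (\<gamma> t) + dist (\<gamma> t) (\<gamma> b)"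
    using dist_triangle[of "\<gamma> s" "\<gamma> t" "\<gamma> b"] closed by (simp add: dist_commute)
  also have "\<dots> = (\<Sum>i<3. dist (\<gamma> (\<tau> i)) (\<gamma> (\<tau> (Suc i))))"
    by (simp add: \<tau>_def eval_nat_numeral)
  finally have "ennreal (2 * dist (\<gamma> s) (\<gamma> t)) \<le> ennreal (\<Sum>i<3. dist (\<gamma> (\<tau> i)) (\<gamma> (\<tau> (Suc i))))"
    by (rule ennreal_leI)
  also have "\<dots> \<le> curve_length \<gamma> a b"
    by (rule polygon_le_curve_length[OF m]) (simp_all add: \<tau>_def)
  finally show ?case .
next
  case (sym s t)
  then show ?case by (simp add: dist_commute)
qed

text \<open>A function \<open>V\<close> that controls the increments of the curve makes the lengths of all inscribed
  polygons telescope.\<close>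

lemma curve_length_le_variation:
  fixes \<gamma> :: "real \<Rightarrow> 'a::metric_space"
  assumes V: "\<And>s t. a \<le> s \<Longrightarrow> s \<le> t \<Longrightarrow> t \<le> b \<Longrightarrow> dist (\<gamma> s) (\<gamma> t) \<le> V t - V s"
  shows "curve_length \<gamma> a b \<le> ennreal (V b - V a)"
  unfolding curve_length_def
proof (rule SUP_least, clarify)
  fix n and t :: "nat \<Rightarrow> real"
  assume t: "mono_on {..n} t" "a = t 0" "b = t n"
  have "(\<Sum>i<n. dist (\<gamma> (t i)) (\<gamma> (t (Suc i)))) \<le> (\<Sum>i<n. V (t (Suc i)) - V (t i))"
    using t by (intro sum_mono V) (auto simp: mono_on_def)
  also have "\<dots> = V (t n) - V (t 0)" by (rule sum_lessThan_telescope)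
  finally show "ennreal (\<Sum>i<n. dist (\<gamma> (t i)) (\<gamma> (t (Suc i)))) \<le> ennreal (V (t n) - V (t 0))"
    by (rule ennreal_leI)
qed

lemma circle_dist_le_L_plus:
  assumes r: "0 \<le> r" "r < 1" and ab: "a \<in> sphere 0 r" "b \<in> sphere 0 r"
  shows "ennreal (2 * dist (f a) (f b)) \<le> L_plus f"
proof -
  obtain s where s: "s \<in> {0..2*pi}" "a = of_real r * cis s"
    using ab(1) Arg2pi[of a] by (metis Arg2pi_eq atLeastAtMost_iff cis_conv_exp dist_0_norm less_imp_le mem_sphere)
  obtain t where t: "t \<in> {0..2*pi}" "b = of_real r * cis t"
    using ab(2) Arg2pi[of b] by (metis Arg2pi_eq atLeastAtMost_iff cis_conv_exp dist_0_norm less_imp_le mem_sphere)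
  have "ennreal (2 * dist (f a) (f b)) \<le> circle_length f r"
    unfolding circle_length_def s(2) t(2)
    by (rule twice_dist_le_closed_curve_length) (use s t in auto)
  also have "\<dots> \<le> L_plus f" unfolding L_plus_def using r by (intro SUP_upper) auto
  finally show ?thesis .
qed

lemma harmonic_dist_le_L_plus:
  assumes f: "canonical_rep (ball 0 1) f G K" and zw: "z \<in> ball 0 1" "w \<in> ball 0 1"
  shows "ennreal (2 * dist (f z) (f w)) \<le> L_plus f"
proof (cases "L_plus f = \<infinity>")
  case False
  then obtain L where L: "L \<ge> 0" "L_plus f = ennreal L"
    by (cases "L_plus f") auto
  obtain r where r: "max (cmod z) (cmod w) < r" "r < 1"
    using dense[of "max (cmod z) (cmod w)" 1] zw by auto
  have r0: "r > 0" using r norm_ge_zero[of z] by linarith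
  have "dist (f z) (f w) \<le> L / 2"
  proof (rule canonical_rep_dist_le_sphere[OF f r0])
    show "dist (f a) (f b) \<le> L / 2" if "a \<in> sphere 0 r" "b \<in> sphere 0 r" for a b
      using circle_dist_le_L_plus[of r a b f] that r r0 L by simp
  qed (use r in auto)
  then show ?thesis using L by simp
qed simp

section \<open>The gradient at the centre\<close>

text \<open>The tangent maps the strip \<open>\<bar>Re w\<bar> < pi / 4\<close> into the unit disk.\<close>

lemma norm_tan_less_1:
  assumes "\<bar>Re w\<bar> < pi / 4"
  shows "cos w \<noteq> 0" and "cmod (tan w) < 1"
proof -
  have "(cmod (cos w))\<^sup>2 - (cmod (sin w))\<^sup>2 = cos (2 * Re w)"
    by (simp add: norm_sin_squared norm_cos_squared exp_double power2_diff power_inverse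
        cos_double_cos add_divide_distrib diff_divide_distrib)
  moreover have "cos (2 * Re w) > 0" using assms by (intro cos_gt_zero_pi) auto
  ultimately have "(cmod (sin w))\<^sup>2 < (cmod (cos w))\<^sup>2" by linarith
  then have lt: "cmod (sin w) < cmod (cos w)" by (rule power2_less_imp_less) simp
  then show "cos w \<noteq> 0" by auto
  then show "cmod (tan w) < 1" using lt by (simp add: tan_def norm_divide)
qed

text \<open>After scaling the strip to width \<open>pi / 2\<close>, composition with the tangent gives a self-map of the
  disk fixing \<open>0\<close>, to which the Schwarz lemma applies. As \<open>tan\<close> has derivative \<open>1\<close> at \<open>0\<close>,
  only the scaling factor enters the bound.\<close>

lemma strip_derivative_bound:
  assumes H: "H holomorphic_on ball 0 1" "H 0 = 0"
    and strip: "\<And>z. z \<in> ball 0 1 \<Longrightarrow> \<bar>Re (H z)\<bar> < M"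
  shows "pi * cmod (deriv H 0) \<le> 4 * M"
proof -
  have M: "M > 0" using strip[of 0] by (simp add: H)
  define c where "c = pi / (4 * M)"
  have c: "c > 0" using M by (simp add: c_def)
  have small: "\<bar>Re (of_real c * H z)\<bar> < pi / 4" if "z \<in> ball 0 1" for z
    using mult_strict_left_mono[OF strip[OF that] c] c M by (simp add: c_def abs_mult)
  define F where "F z = tan (of_real c * H z)" for z
  have hol: "(\<lambda>z. of_real c * H z) holomorphic_on ball 0 1" by (intro holomorphic_intros H)
  have "tan holomorphic_on {w. \<bar>Re w\<bar> < pi / 4}"
    by (rule holomorphic_on_tan) (use norm_tan_less_1(1) in blast)
  then have "tan \<circ> (\<lambda>z. of_real c * H z) holomorphic_on ball 0 1"
    by (rule holomorphic_on_compose_gen[OF hol]) (use small in blast)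
  then have F: "F holomorphic_on ball 0 1" by (simp add: o_def F_def[abs_def])
  have "norm (deriv F 0) \<le> 1"
    by (rule Schwarz_Lemma(2)[OF F, of 0]) (use norm_tan_less_1(2)[OF small] in \<open>auto simp: F_def H\<close>)
  moreover have "(F has_field_derivative of_real c * deriv H 0) (at 0)"
    unfolding F_def[abs_def]
    by (rule derivative_eq_intros holomorphic_derivI[OF H(1)] refl | simp add: H)+
  ultimately have "c * cmod (deriv H 0) \<le> 1"
    using c by (simp add: DERIV_imp_deriv norm_mult)
  then show ?thesis using M by (simp add: c_def field_simps)
qed

text \<open>Rotating \<open>a\<close> and \<open>b\<close> by the same angle in opposite directions brings both to the mean of
  their arguments.\<close>

lemma unimodular_align:
  obtains \<omega> :: complex where "cmod \<omega> = 1" "cmod (\<omega> * a + cnj \<omega> * b) = cmod a + cmod b"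
proof -
  define \<omega> where "\<omega> = cis ((Arg b - Arg a) / 2)"
  have "\<omega> * a = of_real (cmod a) * cis ((Arg a + Arg b) / 2)"
    by (subst rcis_cmod_Arg[of a, symmetric]) (simp add: \<omega>_def rcis_def cis_mult field_simps)
  moreover have "cnj \<omega> * b = of_real (cmod b) * cis ((Arg a + Arg b) / 2)"
    by (subst rcis_cmod_Arg[of b, symmetric]) (simp add: \<omega>_def rcis_def cis_mult cis_cnj field_simps)
  ultimately have "\<omega> * a + cnj \<omega> * b = of_real (cmod a + cmod b) * cis ((Arg a + Arg b) / 2)"
    by (simp add: algebra_simps)
  then have "cmod (\<omega> * a + cnj \<omega> * b) = cmod a + cmod b"
    by (simp add: norm_mult del: of_real_add)
  then show ?thesis using that[of \<omega>] by (simp add: \<omega>_def)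
qed

text \<open>The function \<open>\<Phi> = \<omega> * G + cnj \<omega> * K\<close> has the same real part as \<open>\<omega> * f\<close>, and with \<open>\<omega>\<close> chosen
  to align the two derivatives its derivative at \<open>0\<close> has modulus \<open>Lambda_norm f 0\<close>. Its odd part
  keeps this derivative, vanishes at \<open>0\<close>, and has real part at most \<open>d / 2\<close> in modulus, since it
  only involves the differences \<open>f z - f (- z)\<close>.\<close>

lemma Lambda_norm_bound:
  assumes f: "canonical_rep (ball 0 1) f G K"
    and bd: "\<And>z. z \<in> ball 0 1 \<Longrightarrow> dist (f z) (f (- z)) \<le> d"
  shows "pi * Lambda_norm f 0 \<le> 2 * d"
proof -
  obtain \<omega> where \<omega>: "cmod \<omega> = 1"
    "cmod (\<omega> * deriv G 0 + cnj \<omega> * deriv K 0) = cmod (deriv G 0) + cmod (deriv K 0)"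
    by (rule unimodular_align)
  have GK: "G holomorphic_on ball 0 1" "K holomorphic_on ball 0 1"
    and eq: "\<And>z. z \<in> ball 0 1 \<Longrightarrow> f z = G z + cnj (K z)"
    using f by (auto simp: canonical_rep_def)
  define \<Phi> where "\<Phi> z = \<omega> * G z + cnj \<omega> * K z" for z
  define H where "H z = (\<Phi> z - \<Phi> (- z)) / 2" for z
  have \<Phi>: "\<Phi> holomorphic_on ball 0 1" unfolding \<Phi>_def[abs_def] by (intro holomorphic_intros GK)
  have "\<Phi> \<circ> uminus holomorphic_on ball 0 1"
    by (rule holomorphic_on_compose_gen[OF _ \<Phi>]) (auto intro!: holomorphic_intros)
  then have H: "H holomorphic_on ball 0 1"
    unfolding H_def[abs_def] by (auto simp: o_def intro!: holomorphic_intros \<Phi>)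
  have d\<Phi>: "(\<Phi> has_field_derivative \<omega> * deriv G 0 + cnj \<omega> * deriv K 0) (at 0)"
    unfolding \<Phi>_def[abs_def]
    by (rule derivative_eq_intros holomorphic_derivI[OF GK(1)] holomorphic_derivI[OF GK(2)] refl | simp)+
  then have "((\<lambda>z. \<Phi> (- z)) has_field_derivative (\<omega> * deriv G 0 + cnj \<omega> * deriv K 0) * (-1)) (at 0)"
    by (intro DERIV_chain2[where f = \<Phi>]) (auto intro!: derivative_eq_intros)
  then have "(H has_field_derivative \<omega> * deriv G 0 + cnj \<omega> * deriv K 0) (at 0)"
    unfolding H_def[abs_def] using d\<Phi> by (auto intro!: derivative_eq_intros)
  then have dH: "cmod (deriv H 0) = Lambda_norm f 0"
    using \<omega> by (simp add: DERIV_imp_deriv Lambda_norm_canonical_rep[OF f])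
  have strip: "\<bar>Re (H z)\<bar> \<le> d / 2" if z: "z \<in> ball 0 1" for z
  proof -
    have "Re (H z) = Re (\<omega> * (f z - f (- z))) / 2"
      using eq[of z] eq[of "- z"] z by (simp add: H_def \<Phi>_def algebra_simps)
    then have "\<bar>Re (H z)\<bar> \<le> cmod (\<omega> * (f z - f (- z))) / 2"
      using abs_Re_le_cmod[of "\<omega> * (f z - f (- z))"] by simp
    then show ?thesis using bd[OF z] \<omega> by (simp add: norm_mult dist_norm)
  qed
  \<comment> \<open>The strip has to be open, so it is taken slightly wider than \<open>d\<close>.\<close>
  have "pi * Lambda_norm f 0 \<le> 2 * d + e" if "e > 0" for e
  proof -
    have "pi * cmod (deriv H 0) \<le> 4 * (d / 2 + e / 4)"
      by (rule strip_derivative_bound[OF H]) (use strip that in \<open>force simp: H_def\<close>)+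
    then show ?thesis by (simp add: dH)
  qed
  then show ?thesis by (rule field_le_epsilon)
qed

section \<open>The extremal functions\<close>

lemma cayley_Re_Im:
  fixes z :: complex
  assumes "z \<in> ball 0 1"
  shows "Re ((1 + z) / (1 - z)) > 0"
    and "Im ((1 + z) / (1 - z)) / Re ((1 + z) / (1 - z)) = 2 * Im z / (1 - (cmod z)\<^sup>2)"
proof -
  define D where "D = (1 - Re z)\<^sup>2 + (Im z)\<^sup>2"
  have z1: "(cmod z)\<^sup>2 < 1" using assms by (simp add: power_less_one_iff)
  have "z \<noteq> 1" using assms by auto
  then have D: "D > 0"
    unfolding D_def by (metis complex_eq_iff eq_iff_diff_eq_0 one_complex.simps sum_power2_gt_zero_iff)
  have re: "Re ((1 + z) / (1 - z)) = (1 - (cmod z)\<^sup>2) / D"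
    by (simp add: Re_divide D_def cmod_power2) (simp add: power2_eq_square algebra_simps)?
  have im: "Im ((1 + z) / (1 - z)) = 2 * Im z / D"
    by (simp add: Im_divide D_def cmod_power2) (simp add: power2_eq_square algebra_simps)?
  show "Re ((1 + z) / (1 - z)) > 0" using re D z1 by simp
  show "Im ((1 + z) / (1 - z)) / Re ((1 + z) / (1 - z)) = 2 * Im z / (1 - (cmod z)\<^sup>2)"
    unfolding re im using D z1 by simp
qed

lemma u_fun_eq_arctan:
  fixes z :: complex
  assumes "z \<in> ball 0 1"
  shows "u_fun d z = of_real (d / pi * arctan (2 * Im z / (1 - (cmod z)\<^sup>2)))"
  unfolding u_fun_def arg_conv_arctan[OF cayley_Re_Im(1)[OF assms]] cayley_Re_Im(2)[OF assms] ..

text \<open>Up to the factor \<open>d / pi\<close>, \<open>u_fun d\<close> is the imaginary part of a holomorphic logarithm, so both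
  parts of its decomposition are the same multiple of that logarithm.\<close>

lemma canonical_rep_u_fun:
  obtains G where "canonical_rep (ball 0 1) (u_fun d) G G" "cmod (deriv G 0) = \<bar>d\<bar> / pi"
proof -
  define c where "c = - \<i> * of_real (d / (2 * pi))"
  define G where "G z = c * Ln ((1 + z) / (1 - z))" for z
  have pos: "(1 + z) / (1 - z) \<notin> \<real>\<^sub>\<le>\<^sub>0" "1 - z \<noteq> 0" if "z \<in> ball 0 1" for z :: complex
    using cayley_Re_Im(1)[OF that] that by (auto simp: complex_nonpos_Reals_iff)
  have "canonical_rep (ball 0 1) (u_fun d) G G"
    unfolding canonical_rep_def
  proof (intro conjI ballI)
    show "G holomorphic_on ball 0 1" "G holomorphic_on ball 0 1"
      unfolding G_def[abs_def] by (intro holomorphic_intros; use pos in auto)+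
    fix z :: complex assume z: "z \<in> ball 0 1"
    have "(1 + z) / (1 - z) \<noteq> 0" using cayley_Re_Im(1)[OF z] by (metis less_irrefl zero_complex.simps(1))
    then have "Arg ((1 + z) / (1 - z)) = Im (Ln ((1 + z) / (1 - z)))" by (rule Arg_eq_Im_Ln)
    then show "u_fun d z = G z + cnj (G z)"
      by (simp add: u_fun_def G_def c_def complex_eq_iff field_simps)
  qed simp
  moreover have "(G has_field_derivative c * 2) (at 0)"
    unfolding G_def[abs_def]
    by (rule derivative_eq_intros refl | simp)+
  then have "cmod (deriv G 0) = \<bar>d\<bar> / pi"
    by (simp add: DERIV_imp_deriv c_def norm_mult norm_divide)
  ultimately show ?thesis by (rule that)
qed

text \<open>On each circle \<open>u_fun d\<close> is a nondecreasing function of \<open>sin t\<close> with values in an interval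
  independent of the radius. As \<open>sin\<close> has three intervals of monotonicity on \<open>{0..2 * pi}\<close>, the
  variation is bounded uniformly.\<close>

lemma L_plus_u_fun_finite:
  assumes "d > 0"
  shows "L_plus (u_fun d) < \<infinity>"
proof -
  have "circle_length (u_fun d) r \<le> ennreal (6 * d)" if r: "r \<in> {0..<1}" for r
  proof -
    define k where "k = 2 * r / (1 - r\<^sup>2)"
    have "r\<^sup>2 < 1" using r by (simp add: power_less_one_iff)
    then have k: "k \<ge> 0" using r by (simp add: k_def)
    define \<phi> where "\<phi> t = d / pi * arctan (k * sin t)" for t
    have u: "u_fun d (of_real r * cis t) = of_real (\<phi> t)" for t
      using r by (subst u_fun_eq_arctan) (auto simp: norm_mult \<phi>_def k_def mult.assoc)
    have mono: "\<phi> s \<le> \<phi> t" if "sin s \<le> sin t" for s t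
      using that k assms by (auto simp: \<phi>_def arctan_le_iff intro!: mult_left_mono divide_right_mono)
    have bound: "\<bar>\<phi> t\<bar> \<le> d" for t
    proof -
      have "\<bar>arctan (k * sin t)\<bar> \<le> pi" using arctan_bounded[of "k * sin t"] by auto
      then show ?thesis using assms by (simp add: \<phi>_def abs_mult field_simps)
    qed
    \<comment> \<open>The three terms change only on one interval of monotonicity each;
      the middle one, where \<open>\<phi>\<close> decreases, enters with the opposite sign.\<close>
    define V where "V t = \<phi> (min t (pi/2)) - \<phi> (max (pi/2) (min t (3*pi/2))) + \<phi> (max t (3*pi/2))" for t
    have "dist (u_fun d (of_real r * cis s)) (u_fun d (of_real r * cis t)) \<le> V t - V s"
      if st: "0 \<le> s" "s \<le> t" "t \<le> 2 * pi" for s t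
    proof -
      have 1: "\<phi> (min s (pi/2)) \<le> \<phi> (min t (pi/2))"
        using st by (intro mono sin_monotone_2pi_le) auto
      have 2: "\<phi> (max (pi/2) (min t (3*pi/2))) \<le> \<phi> (max (pi/2) (min s (3*pi/2)))"
      proof (rule mono)
        have "sin (pi - max (pi/2) (min t (3*pi/2))) \<le> sin (pi - max (pi/2) (min s (3*pi/2)))"
          using st by (intro sin_monotone_2pi_le) (auto simp: max_def min_def)
        then show "sin (max (pi/2) (min t (3*pi/2))) \<le> sin (max (pi/2) (min s (3*pi/2)))" by simp
      qed
      have 3: "\<phi> (max s (3*pi/2)) \<le> \<phi> (max t (3*pi/2))"
      proof (rule mono)
        have "sin (max s (3*pi/2) - 2*pi) \<le> sin (max t (3*pi/2) - 2*pi)"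
          using st by (intro sin_monotone_2pi_le) (auto simp: max_def)
        then show "sin (max s (3*pi/2)) \<le> sin (max t (3*pi/2))" by (simp add: sin_diff)
      qed
      have split: "\<phi> x = \<phi> (min x (pi/2)) + (\<phi> (max (pi/2) (min x (3*pi/2))) - \<phi> (pi/2))
          + (\<phi> (max x (3*pi/2)) - \<phi> (3*pi/2))" for x
        by (simp add: min_def max_def) (smt (verit) pi_gt_zero field_sum_of_halves)
      have "\<bar>\<phi> s - \<phi> t\<bar> \<le> V t - V s"
        using 1 2 3 split[of s] split[of t] unfolding V_def by linarith
      then show ?thesis by (simp add: u dist_norm flip: of_real_diff)
    qed
    then have "circle_length (u_fun d) r \<le> ennreal (V (2*pi) - V 0)"
      unfolding circle_length_def by (rule curve_length_le_variation)
    also have "\<dots> \<le> ennreal (6 * d)"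
      using bound unfolding V_def by (intro ennreal_leI) (smt (verit))
    finally show ?thesis .
  qed
  then have "L_plus (u_fun d) \<le> ennreal (6 * d)"
    unfolding L_plus_def by (rule SUP_least)
  then show ?thesis by (simp add: le_less_trans)
qed

text \<open>The values lie strictly between \<open>- d / 2\<close> and \<open>d / 2\<close>, and on the imaginary axis they approach
  both ends: at \<open>\<i> * tan (\<theta> / 2)\<close> the double-angle formula makes the value \<open>d / pi * \<theta>\<close>.\<close>

lemma diameter_u_fun:
  assumes d: "d > 0"
  shows "diameter (u_fun d ` ball 0 1) = d"
proof (rule antisym)
  have dist_le: "dist (u_fun d z) (u_fun d w) \<le> d" if "z \<in> ball 0 1" "w \<in> ball 0 1" for z w
  proof -
    define x where "x = arctan (2 * Im z / (1 - (cmod z)\<^sup>2)) - arctan (2 * Im w / (1 - (cmod w)\<^sup>2))"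
    have "\<bar>x\<bar> \<le> pi"
      using arctan_bounded[of "2 * Im z / (1 - (cmod z)\<^sup>2)"]
        arctan_bounded[of "2 * Im w / (1 - (cmod w)\<^sup>2)"] unfolding x_def by linarith
    then have "\<bar>d / pi * x\<bar> \<le> d" using d by (simp add: abs_mult field_simps)
    moreover have "dist (u_fun d z) (u_fun d w) = \<bar>d / pi * x\<bar>"
      by (simp only: u_fun_eq_arctan[OF that(1)] u_fun_eq_arctan[OF that(2)] dist_of_real dist_real_def
          x_def right_diff_distrib)
    ultimately show ?thesis by simp
  qed
  show "diameter (u_fun d ` ball 0 1) \<le> d"
    by (rule diameter_le) (use dist_le d in \<open>auto simp: dist_norm\<close>)
  have bdd: "bounded (u_fun d ` ball 0 1)"
    unfolding bounded_two_points using dist_le by blast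
  have "d \<le> diameter (u_fun d ` ball 0 1) + e" if e: "e > 0" for e
  proof -
    define q where "q = pi * e / (2 * d)"
    have small: "q > 0" using e d by (simp add: q_def)
    \<comment> \<open>The first argument of \<open>max\<close> only keeps \<open>\<theta>\<close> positive when \<open>e\<close> is large.\<close>
    define \<theta> where "\<theta> = max (pi / 4) (pi / 2 - q)"
    have \<theta>: "0 < \<theta>" "\<theta> < pi / 2" "pi / 2 - q \<le> \<theta>"
      using small by (auto simp: \<theta>_def max_def)
    define t where "t = tan (\<theta> / 2)"
    have t: "0 < t" "t < 1"
      using \<theta> tan_monotone[of "\<theta> / 2" "pi / 4"] by (auto simp: t_def tan_gt_zero tan_45)
    have "tan \<theta> = 2 * t / (1 - t\<^sup>2)"
      using \<theta> tan_double[of "\<theta> / 2"] cos_gt_zero[of \<theta>] cos_gt_zero[of "\<theta>/2"] by (simp add: t_def)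
    then have "arctan (2 * t / (1 - t\<^sup>2)) = \<theta>"
      using \<theta> by (metis arctan_tan less_trans minus_less_iff neg_less_0_iff_less pi_half_gt_zero)
    then have u: "u_fun d (\<i> * of_real t) = of_real (d / pi * \<theta>)"
      "u_fun d (- (\<i> * of_real t)) = of_real (- (d / pi * \<theta>))"
      using t by (simp_all add: u_fun_eq_arctan norm_mult arctan_minus)
    have "dist (u_fun d (\<i> * of_real t)) (u_fun d (- (\<i> * of_real t))) \<le> diameter (u_fun d ` ball 0 1)"
      using t by (intro diameter_bounded_bound bdd imageI) (auto simp: norm_mult)
    moreover have "dist (u_fun d (\<i> * of_real t)) (u_fun d (- (\<i> * of_real t))) = 2 * (d / pi * \<theta>)"
      unfolding u dist_of_real using d \<theta> by (simp add: dist_real_def)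
    moreover have "d - e \<le> 2 * (d / pi * \<theta>)"
    proof -
      have "d - e = 2 * (d / pi * (pi / 2 - q))" using d by (simp add: q_def field_simps)
      also have "\<dots> \<le> 2 * (d / pi * \<theta>)"
        using \<theta>(3) d by (intro mult_left_mono) simp_all
      finally show ?thesis .
    qed
    ultimately show ?thesis by linarith
  qed
  then show "d \<le> diameter (u_fun d ` ball 0 1)" by (rule field_le_epsilon)
qed

theorem theorem16:
  shows "(\<forall>f :: complex \<Rightarrow> complex.
            harmonic_on f (ball 0 1) \<and> L_plus f < \<infinity> \<longrightarrow>
              bounded (f ` ball 0 1) \<and>
              pi * Lambda_norm f 0 \<le> 2 * diameter (f ` ball 0 1) \<and>
              ennreal (2 * diameter (f ` ball 0 1)) \<le> L_plus f) \<and>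
         (\<forall>d::real. d > 0 \<longrightarrow>
            harmonic_on (u_fun d) (ball 0 1) \<and> L_plus (u_fun d) < \<infinity> \<and>
            diameter (u_fun d ` ball 0 1) = d \<and>
            pi * Lambda_norm (u_fun d) 0 = 2 * d)"
proof (intro conjI allI impI; (elim conjE)?)
  fix f :: "complex \<Rightarrow> complex"
  assume f: "harmonic_on f (ball 0 1)" and fin: "L_plus f < \<infinity>"
  obtain G K where rep: "canonical_rep (ball 0 1) f G K"
    using harmonic_on_imp_canonical_rep[OF f] by auto
  obtain L where L: "L \<ge> 0" "L_plus f = ennreal L"
    using fin by (cases "L_plus f") auto
  have dist_le: "dist (f z) (f w) \<le> L / 2" if "z \<in> ball 0 1" "w \<in> ball 0 1" for z w
    using harmonic_dist_le_L_plus[OF rep that] L by simp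
  then show bdd: "bounded (f ` ball 0 1)"
    unfolding bounded_two_points by blast
  show "pi * Lambda_norm f 0 \<le> 2 * diameter (f ` ball 0 1)"
    by (rule Lambda_norm_bound[OF rep]) (auto intro!: diameter_bounded_bound bdd)
  have "diameter (f ` ball 0 1) \<le> L / 2"
    by (rule diameter_le) (use dist_le L in \<open>auto simp: dist_norm\<close>)
  then show "ennreal (2 * diameter (f ` ball 0 1)) \<le> L_plus f"
    unfolding L(2) by (intro ennreal_leI) simp
next
  fix d :: real assume d: "d > 0"
  obtain G where rep: "canonical_rep (ball 0 1) (u_fun d) G G" and G: "cmod (deriv G 0) = \<bar>d\<bar> / pi"
    by (rule canonical_rep_u_fun)
  show "harmonic_on (u_fun d) (ball 0 1)" by (rule canonical_rep_imp_harmonic_on[OF rep])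
  show "pi * Lambda_norm (u_fun d) 0 = 2 * d"
    using Lambda_norm_canonical_rep[OF rep, of 0] G d by simp
  show "L_plus (u_fun d) < \<infinity>" by (rule L_plus_u_fun_finite[OF d])
  show "diameter (u_fun d ` ball 0 1) = d" by (rule diameter_u_fun[OF d])
qed

end
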